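(* Suppose that the dual of (P) has the error bound property. Let $\kappa>0$ be a constant such that $\|x-\bar x\|\le\kappa\|\nabla^+d(x)\|$ for all $x\in\mathcal{K}^*$ with $f^*-d(x)\le f^*-d(x^{0,0})$, let $(x^{k,j},y^{k,j})$ be generated by Algorithm (R-DFG) with $c=1/e$, i.e. with restart interval $K_c=\lfloor 2e\kappa\rfloor$, and for an integer $p\ge1$ and $k=pK_c$ put $v^k=u(x^{K_c,p-1})$. Then the last primal iterate $v^k$ is an $\epsilon$-primal solution of (P) after $k=pK_c=\mathcal{O}(\log(1/\epsilon))$ iterations; that is, there exist constants $C_1,C_2>0$, independent of $\epsilon$ and $p$, such that for every $\epsilon\in(0,1)$ and every integer $p\ge1$ with $k=pK_c\ge C_1\log(1/\epsilon)$, $$\mathrm{dist}_{\mathcal{K}}(Gv^k+g)\le C_2\,\epsilon \quad\text{and}\quad -C_2\,\epsilon\le f(v^k)-f^*\le C_2\,\epsilon .$$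
   Context: Problem (P): $f^* = \min_{u \in U} f(u)$ subject to $Gu + g \in \mathcal{K}$, where $f:\mathbb{R}^n \to \mathbb{R}$ is $\sigma_{\mathrm f}$-strongly convex with respect to the Euclidean norm $\|\cdot\|$ ($\sigma_{\mathrm f}>0$), $G \in \mathbb{R}^{p'\times n}$ ($G\ne 0$), $g \in \mathbb{R}^{p'}$, $\mathcal{K}\subseteq\mathbb{R}^{p'}$ is a proper cone (closed, convex, pointed, nonempty interior), and $U \subseteq \mathbb{R}^n$ is a nonempty closed convex set. $\mathcal{K}^* = \{x : \langle x,z\rangle \ge 0\ \forall z\in\mathcal{K}\}$ is the dual cone. The Lagrangian is $\mathcal{L}(u,x) = f(u) - \langle x, Gu+g\rangle$, the dual function is $d(x) = \min_{u\in U}\mathcal{L}(u,x)$ for $x \in \mathbb{R}^{p'}$, and $u(x)$ is the unique minimizer of $\mathcal{L}(\cdot,x)$ over $U$. The function $d$ is concave and differentiable on $\mathbb{R}^{p'}$ with $\nabla d(x) = -Gu(x)-g$, Lipschitz with constant $L_{\mathrm d} = \|G\|^2/\sigma_{\mathrm f}$ ($\|G\|$ the spectral norm). Standing assumption: there exists a finite optimal Lagrange multiplier for the conic constraint, so that $f^* = \max_{x\in\mathcal{K}^*} d(x)$ and the set $X^*\subseteq\mathcal{K}^*$ of maximizers is nonempty. $[z]_C$ denotes Euclidean projection onto $C$, $\mathrm{dist}_C(z)=\min_{w\in C}\|w-z\|$; $\bar x=[x]_{X^*}$; the gradient map is $\nabla^+d(x)=\left[x+\frac1{L_{\mathrm d}}\nabla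 d(x)\right]_{\mathcal{K}^*}-x$. Error bound property: for every $M>0$ there exists $\kappa>0$ (depending on $M$ and the problem data) such that $\|x-\bar x\|\le\kappa\|\nabla^+d(x)\|$ for all $x\in\mathcal{K}^*$ with $f^*-d(x)\le M$. Algorithm (DFG): given $x^0=y^1\in\mathcal{K}^*$ and $\theta_1=1$, for $k\ge1$ compute $u^k=u(y^k)$, $x^k=\left[y^k+\frac{1}{L_{\mathrm d}}\nabla d(y^k)\right]_{\mathcal{K}^*}$, $\theta_{k+1}=\frac{1+\sqrt{1+4\theta_k^2}}{2}$, and $y^{k+1}=x^k+\frac{\theta_k-1}{\theta_{k+1}}(x^k-x^{k-1})$. Algorithm (R-DFG): given $x^{0,0}=y^{1,0}\in\mathcal{K}^*$ and a restart interval $K_c=\lfloor 2\kappa/c\rfloor$ with $c\in(0,1)$, for $j\ge0$: run Algorithm (DFG) for $K_c$ iterations starting from $x^{0,j}=y^{1,j}$, producing iterates $x^{k,j},y^{k,j}$ and finally $x^{K_c,j}$; then restart with $x^{0,j+1}=x^{K_c,j}$, $y^{1,j+1}=x^{K_c,j}$ and $\theta_1=1$. $\tilde u\in U$ is an $\epsilon$-primal solution if $\mathrm{dist}_{\mathcal{K}}(G\tilde u+g)\le\mathcal{O}(\epsilon)$ and $-\mathcal{O}(\epsilon)\le f(\tilde u)-f^*\le\mathcal{O}(\epsilon)$; constants in $\mathcal{O}$ may depend on the problem data, $x^{0,0}$ and $\kappa$, but not on $\epsilon$ or $p$. *)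

theory Defs
  imports "HOL-Analysis.Analysis"
begin

definition strongly_convex :: "real \<Rightarrow> ('a::real_normed_vector \<Rightarrow> real) \<Rightarrow> bool" where
  "strongly_convex \<sigma> f \<longleftrightarrow> (\<forall>x y. \<forall>t\<in>{0..1}.
     f ((1 - t) *\<^sub>R x + t *\<^sub>R y)
       \<le> (1 - t) * f x + t * f y - \<sigma> / 2 * t * (1 - t) * (norm (x - y))\<^sup>2)"

definition proper_cone :: "'a::real_normed_vector set \<Rightarrow> bool" where
  "proper_cone K \<longleftrightarrow>
     closed K \<and> convex_cone K \<and> (\<forall>z. z \<in> K \<and> - z \<in> K \<longrightarrow> z = 0) \<and> interior K \<noteq> {}"

definition dual_cone :: "'a::real_inner set \<Rightarrow> 'a set" where
  "dual_cone K = {x. \<forall>z\<in>K. 0 \<le> inner x z}"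

definition feasible :: "(real^'n) set \<Rightarrow> real^'n^'m \<Rightarrow> real^'m \<Rightarrow> (real^'m) set \<Rightarrow> (real^'n) set" where
  "feasible U G g K = {u \<in> U. G *v u + g \<in> K}"

text \<open>The infima below are real-valued, so \<open>opt_value\<close> is meaningful only when the
  feasible set is nonempty. If \<open>f\<close> is strongly convex and \<open>U\<close>, \<open>K\<close> are closed and convex,
  with \<open>U\<close> nonempty, the infima are attained, i.e. they are minima.\<close>

definition opt_value ::
  "(real^'n \<Rightarrow> real) \<Rightarrow> (real^'n) set \<Rightarrow> real^'n^'m \<Rightarrow> real^'m \<Rightarrow> (real^'m) set \<Rightarrow> real" where
  "opt_value f U G g K = (INF u\<in>feasible U G g K. f u)"

definition lagrangian ::
  "(real^'n \<Rightarrow> real) \<Rightarrow> real^'n^'m \<Rightarrow> real^'m \<Rightarrow> real^'n \<Rightarrow> real^'m \<Rightarrow> real" where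
  "lagrangian f G g u x = f u - inner x (G *v u + g)"

definition dual_fun ::
  "(real^'n \<Rightarrow> real) \<Rightarrow> (real^'n) set \<Rightarrow> real^'n^'m \<Rightarrow> real^'m \<Rightarrow> real^'m \<Rightarrow> real" where
  "dual_fun f U G g x = (INF u\<in>U. lagrangian f G g u x)"

definition lagrangian_minimizer ::
  "(real^'n \<Rightarrow> real) \<Rightarrow> (real^'n) set \<Rightarrow> real^'n^'m \<Rightarrow> real^'m \<Rightarrow> real^'m \<Rightarrow> real^'n" where
  "lagrangian_minimizer f U G g x = arg_min_on (\<lambda>u. lagrangian f G g u x) U"

definition maximizers :: "('a \<Rightarrow> real) \<Rightarrow> 'a set \<Rightarrow> 'a set" where
  "maximizers d C = {x \<in> C. \<forall>z\<in>C. d z \<le> d x}"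

text \<open>The norm of \<open>G\<close> is the spectral one: the operator norm for the Euclidean norms.\<close>

definition dual_lipschitz :: "real \<Rightarrow> real^'n^'m \<Rightarrow> real" where
  "dual_lipschitz \<sigma> G = (onorm ((*v) G))\<^sup>2 / \<sigma>"

definition gradient :: "('a::real_inner \<Rightarrow> real) \<Rightarrow> 'a \<Rightarrow> 'a" where
  "gradient d x = (THE D. GDERIV d x :> D)"

definition projected_step ::
  "('a::euclidean_space \<Rightarrow> real) \<Rightarrow> real \<Rightarrow> 'a set \<Rightarrow> 'a \<Rightarrow> 'a" where
  "projected_step d L C x = closest_point C (x + (1 / L) *\<^sub>R gradient d x)"

definition gradient_map ::
  "('a::euclidean_space \<Rightarrow> real) \<Rightarrow> real \<Rightarrow> 'a set \<Rightarrow> 'a \<Rightarrow> 'a" where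
  "gradient_map d L C x = projected_step d L C x - x"

text \<open>The bound \<open>norm (x - [x]\<^sub>X) \<le> \<kappa> * norm (gradient_map x)\<close> on the part of \<open>C\<close> where
  the dual gap is at most \<open>M\<close>, with \<open>X\<close> the set of maximizers of \<open>d\<close> over \<open>C\<close>.\<close>

definition error_bound_const ::
  "real \<Rightarrow> ('a::euclidean_space \<Rightarrow> real) \<Rightarrow> real \<Rightarrow> 'a set \<Rightarrow> real \<Rightarrow> real \<Rightarrow> bool" where
  "error_bound_const fstar d L C M \<kappa> \<longleftrightarrow> (\<forall>x\<in>C. fstar - d x \<le> M \<longrightarrow>
     norm (x - closest_point (maximizers d C) x) \<le> \<kappa> * norm (gradient_map d L C x))"

definition error_bound_property ::
  "real \<Rightarrow> ('a::euclidean_space \<Rightarrow> real) \<Rightarrow> real \<Rightarrow> 'a set \<Rightarrow> bool" where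
  "error_bound_property fstar d L C \<longleftrightarrow> (\<forall>M>0. \<exists>\<kappa>>0. error_bound_const fstar d L C M \<kappa>)"

text \<open>\<open>dfg_run d L C S N w x y \<theta>\<close>: the sequences \<open>w\<close> (primal), \<open>x\<close>, \<open>y\<close>, \<open>\<theta>\<close> arise from
  \<open>N\<close> iterations of the dual fast gradient method started at \<open>x 0\<close>, where \<open>S\<close> maps a
  multiplier to the minimizer of its Lagrangian. The sequences \<open>w\<close>, \<open>y\<close>, \<open>\<theta>\<close> are indexed
  from \<open>1\<close>; other entries are unconstrained.\<close>

definition dfg_run ::
  "('a::euclidean_space \<Rightarrow> real) \<Rightarrow> real \<Rightarrow> 'a set \<Rightarrow> ('a \<Rightarrow> 'b) \<Rightarrow> nat \<Rightarrow>
   (nat \<Rightarrow> 'b) \<Rightarrow> (nat \<Rightarrow> 'a) \<Rightarrow> (nat \<Rightarrow> 'a) \<Rightarrow> (nat \<Rightarrow> real) \<Rightarrow> bool" where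
  "dfg_run d L C S N w x y \<theta> \<longleftrightarrow>
     y 1 = x 0 \<and> \<theta> 1 = 1 \<and>
     (\<forall>k\<in>{1..N}.
        w k = S (y k) \<and>
        x k = projected_step d L C (y k) \<and>
        \<theta> (k + 1) = (1 + sqrt (1 + 4 * (\<theta> k)\<^sup>2)) / 2 \<and>
        y (k + 1) = x k + ((\<theta> k - 1) / \<theta> (k + 1)) *\<^sub>R (x k - x (k - 1)))"

text \<open>Restarted method: the first index counts iterations within a run, the second counts
  restarts. The equality \<open>y 1 (j + 1) = x N j\<close> follows from the clause \<open>y 1 = x 0\<close> of
  \<open>dfg_run\<close>.\<close>

definition restarted_dfg ::
  "('a::euclidean_space \<Rightarrow> real) \<Rightarrow> real \<Rightarrow> 'a set \<Rightarrow> ('a \<Rightarrow> 'b) \<Rightarrow> nat \<Rightarrow> 'a \<Rightarrow>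
   (nat \<Rightarrow> nat \<Rightarrow> 'b) \<Rightarrow> (nat \<Rightarrow> nat \<Rightarrow> 'a) \<Rightarrow> (nat \<Rightarrow> nat \<Rightarrow> 'a) \<Rightarrow> (nat \<Rightarrow> nat \<Rightarrow> real) \<Rightarrow> bool" where
  "restarted_dfg d L C S N x0 w x y \<theta> \<longleftrightarrow>
     x 0 0 = x0 \<and>
     (\<forall>j. dfg_run d L C S N (\<lambda>k. w k j) (\<lambda>k. x k j) (\<lambda>k. y k j) (\<lambda>k. \<theta> k j)) \<and>
     (\<forall>j. x 0 (j + 1) = x N j)"

text \<open>\<open>B\<close> is the constant hidden in the \<open>O(\<epsilon>)\<close> bounds.\<close>

definition approx_primal_solution ::
  "(real^'n \<Rightarrow> real) \<Rightarrow> (real^'n) set \<Rightarrow> real^'n^'m \<Rightarrow> real^'m \<Rightarrow> (real^'m) set \<Rightarrow>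
   real \<Rightarrow> real \<Rightarrow> real^'n \<Rightarrow> bool" where
  "approx_primal_solution f U G g K B \<epsilon> v \<longleftrightarrow>
     v \<in> U \<and> infdist (G *v v + g) K \<le> B * \<epsilon> \<and>
     - (B * \<epsilon>) \<le> f v - opt_value f U G g K \<and> f v - opt_value f U G g K \<le> B * \<epsilon>"

end

theory Submission
  imports Defs
begin

text \<open>The dual iterates converge linearly, and primal accuracy is then read off from the dual gap.

  Strong convexity makes the Lagrangian minimizer \<open>u(x)\<close> unique and, quantitatively, gives growth
  \<open>\<sigma>/2 \<parallel>u(x) - v\<parallel>\<^sup>2\<close> of the Lagrangian away from it. Comparing the growth at two multipliers sandwiches
  the dual function between its linearizations and these minus \<open>L/2 \<parallel>z - y\<parallel>\<^sup>2\<close>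
  (\<open>dual_fun_smooth_concave\<close>), which is all that the analysis of the accelerated method uses:
  \<open>N \<ge> 1\<close> iterations from \<open>x\<^sub>0\<close> leave a gap of at most \<open>2 L \<parallel>x\<^sub>0 - z\<parallel>\<^sup>2 / (N + 1)\<^sup>2\<close> for any dual optimum \<open>z\<close>
  (\<open>dfg_run_rate\<close>). Take for \<open>z\<close> the optimum nearest to \<open>x\<^sub>0\<close>. The error bound gives
  \<open>\<parallel>x\<^sub>0 - z\<parallel> \<le> \<kappa> \<parallel>\<nabla>\<^sup>+ d(x\<^sub>0)\<parallel>\<close>, and a projected gradient step gains at least \<open>L/2 \<parallel>\<nabla>\<^sup>+ d(x\<^sub>0)\<parallel>\<^sup>2\<close>, so the
  squared gradient map is at most \<open>2/L\<close> times the gap at \<open>x\<^sub>0\<close>. Together, one run multiplies the gap by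
  at most \<open>(2 \<kappa> / (N + 1))\<^sup>2\<close> (\<open>dfg_run_contraction\<close>). The restart interval is the largest integer not
  exceeding \<open>2 e \<kappa>\<close>, so this factor is below \<open>e\<^sup>-\<^sup>2\<close>, and \<open>p\<close> runs leave a gap of at most
  \<open>e\<^sup>-\<^sup>2\<^sup>p\<close> times the initial one.

  On the primal side, the growth of the Lagrangian at a primal optimum \<open>u\<^sup>*\<close> bounds
  \<open>\<sigma>/2 \<parallel>u(x) - u\<^sup>*\<parallel>\<^sup>2\<close> by the dual gap at \<open>x\<close> (\<open>primal_distance_le_dual_gap\<close>). The square root turns
  \<open>e\<^sup>-\<^sup>2\<^sup>p\<close> into \<open>e\<^sup>-\<^sup>p\<close>, so \<open>p \<ge> ln (1/\<epsilon>)\<close> puts the last primal iterate within \<open>O(\<epsilon>)\<close> of \<open>u\<^sup>*\<close>. Both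
  infeasibility and suboptimality are then \<open>O(\<epsilon>)\<close>, since the constraint map is Lipschitz and a finite
  convex function grows at most linearly near a point (\<open>convex_local_linear_bound\<close>).\<close>

section \<open>Strongly convex functions\<close>

lemma strongly_convexD:
  assumes "strongly_convex \<sigma> h" "0 \<le> t" "t \<le> 1"
  shows "h ((1 - t) *\<^sub>R x + t *\<^sub>R y)
       \<le> (1 - t) * h x + t * h y - \<sigma> / 2 * t * (1 - t) * (norm (x - y))\<^sup>2"
  using assms by (auto simp: strongly_convex_def)

lemma strongly_convex_imp_convex_on:
  fixes h :: "'a::real_normed_vector \<Rightarrow> real"
  assumes "strongly_convex \<sigma> h" "\<sigma> > 0"
  shows "convex_on UNIV h"
proof (rule convex_onI)
  fix t :: real and x y :: 'a assume t: "0 < t" "t < 1"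
  have "0 \<le> \<sigma> / 2 * t * (1 - t) * (norm (x - y))\<^sup>2"
    using t assms(2) by (intro mult_nonneg_nonneg) auto
  with strongly_convexD[OF assms(1), of t x y] t
  show "h ((1 - t) *\<^sub>R x + t *\<^sub>R y) \<le> (1 - t) * h x + t * h y" by linarith
qed simp

lemma strongly_convex_continuous:
  fixes h :: "'a::euclidean_space \<Rightarrow> real"
  assumes "strongly_convex \<sigma> h" "\<sigma> > 0"
  shows "continuous_on A h"
  using convex_on_continuous[OF open_UNIV strongly_convex_imp_convex_on[OF assms]]
    continuous_on_subset by blast

text \<open>A strongly convex function is coercive. Let \<open>b\<close> minimize \<open>h\<close> over the unit ball around \<open>a\<close>. Along the
  segment from \<open>a\<close> to a point at distance \<open>r \<ge> 1\<close>, the point at distance \<open>1\<close> from \<open>a\<close> has value at least \<open>h b\<close>;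
  the quadratic term in the convexity inequality then forces \<open>h\<close> at the far end above \<open>h a\<close> as soon
  as \<open>\<sigma>/2 (r - 1) \<ge> h a - h b\<close>. So only a compact piece of \<open>S\<close> matters.\<close>

lemma strongly_convex_minimum_exists:
  fixes h :: "'a::euclidean_space \<Rightarrow> real"
  assumes sc: "strongly_convex \<sigma> h" and \<sigma>: "\<sigma> > 0" and S: "closed S" "S \<noteq> {}"
  shows "\<exists>u\<in>S. \<forall>v\<in>S. h u \<le> h v"
proof -
  obtain a where a: "a \<in> S" using S by blast
  obtain b where b: "b \<in> cball a 1" "\<forall>v\<in>cball a 1. h b \<le> h v"
    using continuous_attains_inf[OF compact_cball _ strongly_convex_continuous[OF sc \<sigma>], of a 1]
    by auto
  define R where "R = 1 + 2 * (h a - h b) / \<sigma>"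
  have hab: "h b \<le> h a" using b by auto
  then have R: "R \<ge> 1" using \<sigma> by (simp add: R_def)
  have far: "h a \<le> h v" if v: "norm (a - v) \<ge> R" for v
  proof -
    define r where "r = norm (a - v)"
    have r: "r \<ge> 1" "r \<ge> R" using v R by (auto simp: r_def)
    define w where "w = (1 - 1/r) *\<^sub>R a + (1/r) *\<^sub>R v"
    have "a - w = (1/r) *\<^sub>R (a - v)" by (simp add: w_def algebra_simps)
    then have "norm (a - w) = 1" using r by (simp add: r_def[symmetric])
    then have "w \<in> cball a 1" by (simp add: dist_norm)
    then have "h b \<le> h w" using b by blast
    also have "\<dots> \<le> (1 - 1/r) * h a + (1/r) * h v - \<sigma> / 2 * (1/r) * (1 - 1/r) * r\<^sup>2"
      unfolding w_def r_def by (rule strongly_convexD[OF sc]) (use r in \<open>auto simp: r_def[symmetric] divide_le_eq_1\<close>)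
    finally have "r * h b \<le> r * ((1 - 1/r) * h a + (1/r) * h v - \<sigma> / 2 * (1/r) * (1 - 1/r) * r\<^sup>2)"
      using r by (intro mult_left_mono) auto
    also have "\<dots> = (r - 1) * h a + h v - \<sigma> / 2 * (r - 1) * r"
      using r by (simp add: field_simps power2_eq_square)
    finally have A: "h v - h a \<ge> r * (\<sigma> / 2 * (r - 1) - (h a - h b))"
      by (simp add: algebra_simps)
    have "\<sigma> / 2 * (r - 1) \<ge> \<sigma> / 2 * (R - 1)" using \<sigma> r by auto
    also have "\<sigma> / 2 * (R - 1) = h a - h b" using \<sigma> by (simp add: R_def)
    finally have "0 \<le> r * (\<sigma> / 2 * (r - 1) - (h a - h b))" using r by simp
    with A show ?thesis by linarith
  qed
  have "compact (S \<inter> cball a R)" using S by (simp add: closed_Int_compact)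
  moreover have aR: "a \<in> S \<inter> cball a R" using a R by simp
  ultimately obtain u where u: "u \<in> S \<inter> cball a R" "\<forall>v\<in>S \<inter> cball a R. h u \<le> h v"
    using continuous_attains_inf[OF _ _ strongly_convex_continuous[OF sc \<sigma>]] by blast
  have "h u \<le> h v" if "v \<in> S" for v
  proof (cases "v \<in> cball a R")
    case True then show ?thesis using u that by blast
  next
    case False
    then have "h a \<le> h v" by (intro far) (auto simp: dist_norm)
    moreover have "h u \<le> h a" using u aR by blast
    ultimately show ?thesis by linarith
  qed
  with u show ?thesis by blast
qed

text \<open>Moving from the minimizer \<open>u\<close> a fraction \<open>t\<close> of the way to \<open>v\<close> cannot decrease \<open>h\<close>. Dividing the strong
  convexity inequality by \<open>t\<close> and letting \<open>t\<close> tend to \<open>0\<close> yields the bound.\<close>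

lemma strongly_convex_quadratic_growth:
  assumes sc: "strongly_convex \<sigma> h" and S: "convex S"
    and u: "u \<in> S" "\<And>v. v \<in> S \<Longrightarrow> h u \<le> h v" and v: "v \<in> S"
  shows "h u + \<sigma> / 2 * (norm (u - v))\<^sup>2 \<le> h v"
proof -
  have "\<sigma> / 2 * (norm (u - v))\<^sup>2 \<le> h v - h u"
  proof (rule field_le_mult_one_interval)
    fix s :: real assume s: "0 < s" "s < 1"
    define t where "t = 1 - s"
    have t: "0 < t" "t < 1" "s = 1 - t" using s by (auto simp: t_def)
    have "(1 - t) *\<^sub>R u + t *\<^sub>R v \<in> S" using S u(1) v t by (intro convexD) auto
    then have "h u \<le> h ((1 - t) *\<^sub>R u + t *\<^sub>R v)" by (rule u(2))
    also have "\<dots> \<le> (1 - t) * h u + t * h v - \<sigma> / 2 * t * (1 - t) * (norm (u - v))\<^sup>2"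
      using t by (intro strongly_convexD[OF sc]) auto
    finally have "t * (s * (\<sigma> / 2 * (norm (u - v))\<^sup>2)) \<le> t * (h v - h u)"
      by (simp add: t(3) algebra_simps)
    then show "s * (\<sigma> / 2 * (norm (u - v))\<^sup>2) \<le> h v - h u" using t(1) by simp
  qed
  then show ?thesis by linarith
qed

text \<open>If \<open>v = a + \<epsilon> w\<close> with \<open>\<parallel>w\<parallel> \<le> R\<close>, then \<open>v\<close> is a convex combination of
  \<open>a\<close> and \<open>a + w\<close>, while \<open>a\<close> is one of \<open>v\<close> and \<open>a - w\<close>. Convexity along these two segments bounds
  \<open>h v - h a\<close> from above and from below by \<open>\<epsilon>\<close> times the rise of \<open>h\<close> over the ball of radius \<open>R\<close>.\<close>

lemma convex_local_linear_bound:
  fixes h :: "'a::euclidean_space \<Rightarrow> real"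
  assumes h: "convex_on UNIV h"
  shows "\<exists>B\<ge>0. \<forall>\<epsilon>\<in>{0<..<1}. \<forall>v. norm (v - a) \<le> \<epsilon> * R \<longrightarrow> \<bar>h v - h a\<bar> \<le> B * \<epsilon>"
proof -
  have "continuous_on (cball a R) h"
    using convex_on_continuous[OF open_UNIV h] continuous_on_subset by blast
  then have "bounded (h ` cball a R)"
    by (intro compact_imp_bounded compact_continuous_image) auto
  then obtain M where M: "\<And>w. w \<in> cball a R \<Longrightarrow> \<bar>h w\<bar> \<le> M"
    unfolding bounded_iff real_norm_def by blast
  define B where "B = \<bar>M - h a\<bar>"
  have B: "h w - h a \<le> B" if "w \<in> cball a R" for w
    using M[OF that] by (auto simp: B_def)
  have "\<bar>h v - h a\<bar> \<le> B * \<epsilon>" if \<epsilon>: "0 < \<epsilon>" "\<epsilon> < 1" and v: "norm (v - a) \<le> \<epsilon> * R" for \<epsilon> v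
  proof -
    define w where "w = (1/\<epsilon>) *\<^sub>R (v - a)"
    have w: "norm w \<le> R" using v \<epsilon> by (simp add: w_def divide_le_eq mult.commute)
    have v_eq: "v = (1 - \<epsilon>) *\<^sub>R a + \<epsilon> *\<^sub>R (a + w)"
      using \<epsilon> by (simp add: w_def algebra_simps)
    have a_eq: "a = (1 / (1 + \<epsilon>)) *\<^sub>R v + (\<epsilon> / (1 + \<epsilon>)) *\<^sub>R (a - w)"
    proof -
      have "(1 + \<epsilon>) *\<^sub>R a = v + \<epsilon> *\<^sub>R (a - w)" using \<epsilon> by (simp add: w_def algebra_simps)
      then have "(1 / (1 + \<epsilon>)) *\<^sub>R ((1 + \<epsilon>) *\<^sub>R a) = (1 / (1 + \<epsilon>)) *\<^sub>R (v + \<epsilon> *\<^sub>R (a - w))" by simp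
      then show ?thesis using \<epsilon> by (simp add: scaleR_add_right)
    qed
    have "h v \<le> (1 - \<epsilon>) * h a + \<epsilon> * h (a + w)"
      unfolding v_eq by (rule convex_onD[OF h]) (use \<epsilon> in auto)
    then have "h v - h a \<le> \<epsilon> * (h (a + w) - h a)" by (simp add: algebra_simps)
    also have "\<dots> \<le> \<epsilon> * B" using \<epsilon> w by (intro mult_left_mono B) (auto simp: dist_norm)
    finally have up: "h v - h a \<le> B * \<epsilon>" by (simp add: mult.commute)
    have "h a \<le> (1 / (1 + \<epsilon>)) * h v + (\<epsilon> / (1 + \<epsilon>)) * h (a - w)"
      by (subst (1) a_eq, rule convex_on_def[THEN iffD1, OF h, THEN conjunct2, rule_format])
        (use \<epsilon> in \<open>auto simp: field_simps\<close>)
    also have "\<dots> = (h v + \<epsilon> * h (a - w)) / (1 + \<epsilon>)" by (simp add: add_divide_distrib)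
    finally have "h a * (1 + \<epsilon>) \<le> h v + \<epsilon> * h (a - w)"
      using \<epsilon> by (subst (asm) pos_le_divide_eq) auto
    then have "h a - h v \<le> \<epsilon> * (h (a - w) - h a)" by (simp add: algebra_simps)
    also have "\<dots> \<le> \<epsilon> * B" using \<epsilon> w by (intro mult_left_mono B) (auto simp: dist_norm)
    finally have "h a - h v \<le> B * \<epsilon>" by (simp add: mult.commute)
    with up show ?thesis by linarith
  qed
  then show ?thesis by (intro exI[of _ B]) (auto simp: B_def)
qed

section \<open>The accelerated projected gradient method\<close>

text \<open>For a differentiable \<open>d\<close>, the two inequalities express concavity and the descent-lemma
  consequence of an \<open>L\<close>-Lipschitz gradient; this is the form in which both are used below.\<close>

definition smooth_concave :: "('a::real_inner \<Rightarrow> real) \<Rightarrow> real \<Rightarrow> bool" where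
  "smooth_concave d L \<longleftrightarrow> (\<forall>y z. d z \<le> d y + inner (gradient d y) (z - y) \<and>
     d y + inner (gradient d y) (z - y) - L / 2 * (norm (z - y))\<^sup>2 \<le> d z)"

text \<open>A quadratic sandwich around an affine function identifies its slope as the gradient, so
  differentiability of the dual function, itself an infimum, comes out of its two bounds.\<close>

lemma smooth_concave_from_bounds:
  fixes d :: "'a::real_inner \<Rightarrow> real"
  assumes up: "\<And>y z. d z \<le> d y + inner (D y) (z - y)"
    and lo: "\<And>y z. d y + inner (D y) (z - y) - L / 2 * (norm (z - y))\<^sup>2 \<le> d z"
  shows "smooth_concave d L" and "continuous_on A d"
proof -
  have der: "GDERIV d y :> D y" for y
    unfolding gderiv_def
  proof (rule has_derivativeI_sandwich[where e = 1 and H = "\<lambda>z. \<bar>L\<bar> / 2 * norm (z - y)"])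
    show "bounded_linear (\<lambda>h. inner h (D y))" by (rule bounded_linear_inner_left)
    show "((\<lambda>z. \<bar>L\<bar> / 2 * norm (z - y)) \<longlongrightarrow> 0) (at y)"
      by (auto intro!: tendsto_eq_intros)
    fix z assume z: "z \<noteq> y"
    have "\<bar>d z - d y - inner (z - y) (D y)\<bar> \<le> \<bar>L\<bar> / 2 * (norm (z - y))\<^sup>2"
    proof -
      have "L / 2 * (norm (z - y))\<^sup>2 \<le> \<bar>L\<bar> / 2 * (norm (z - y))\<^sup>2" by (intro mult_right_mono) auto
      moreover have "0 \<le> \<bar>L\<bar> / 2 * (norm (z - y))\<^sup>2" by simp
      ultimately show ?thesis using up[of z y] lo[of y z] by (simp add: inner_commute)
    qed
    then show "norm (d z - d y - inner (z - y) (D y)) / norm (z - y) \<le> \<bar>L\<bar> / 2 * norm (z - y)"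
      using z by (simp add: divide_le_eq power2_eq_square mult.assoc)
  qed simp
  have "gradient d y = D y" for y
    unfolding gradient_def
  proof (rule the_equality)
    show "GDERIV d y :> D y" by (rule der)
    fix E assume "GDERIV d y :> E"
    then have "(\<lambda>h. inner h E) = (\<lambda>h. inner h (D y))"
      using der[of y] has_derivative_unique unfolding gderiv_def by blast
    then show "E = D y" by (metis inner_commute vector_eq_ldot)
  qed
  then show "smooth_concave d L" using up lo by (simp add: smooth_concave_def)
  show "continuous_on A d"
    using der has_derivative_continuous unfolding gderiv_def
    by (intro continuous_at_imp_continuous_on) blast
qed

text \<open>The graph lies below its tangent at \<open>z = (1 - t) x + t y\<close>; averaging the tangent bounds at \<open>x\<close> and \<open>y\<close>
  cancels the linear terms.\<close>

lemma smooth_concave_concave: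
  assumes d: "smooth_concave d L" and t: "0 \<le> t" "t \<le> 1"
  shows "(1 - t) * d x + t * d y \<le> d ((1 - t) *\<^sub>R x + t *\<^sub>R y)"
proof -
  define z where "z = (1 - t) *\<^sub>R x + t *\<^sub>R y"
  define D where "D = gradient d z"
  have "d x \<le> d z + inner D (x - z)" "d y \<le> d z + inner D (y - z)"
    using d by (auto simp: smooth_concave_def D_def)
  then have "(1 - t) * d x + t * d y
      \<le> (1 - t) * (d z + inner D (x - z)) + t * (d z + inner D (y - z))"
    using t by (intro add_mono mult_left_mono) auto
  also have "\<dots> = d z + inner D ((1 - t) *\<^sub>R (x - z) + t *\<^sub>R (y - z))"
    by (simp add: algebra_simps)
  also have "(1 - t) *\<^sub>R (x - z) + t *\<^sub>R (y - z) = 0"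
    by (simp add: z_def algebra_simps)
  finally show ?thesis by (simp add: z_def)
qed

text \<open>The one inequality on which the convergence proof rests. The step is the maximizer over \<open>C\<close> of the
  quadratic minorant of \<open>d\<close> at \<open>y\<close>, and that minorant is itself strongly concave; the upper linear bound
  brings in \<open>d z\<close>. The point \<open>y\<close> may lie outside \<open>C\<close>, as happens after extrapolation.\<close>

lemma projected_step_ascent:
  assumes d: "smooth_concave d L" and L: "L > 0" and C: "closed C" "convex C" and z: "z \<in> C"
  shows "d z + L / 2 * (norm (projected_step d L C y - z))\<^sup>2 - L / 2 * (norm (y - z))\<^sup>2
    \<le> d (projected_step d L C y)"
proof -
  define D where "D = gradient d y"
  define p where "p = projected_step d L C y"
  have p_eq: "p = closest_point C (y + (1 / L) *\<^sub>R D)"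
    by (simp add: p_def projected_step_def D_def)
  have "inner (y + (1 / L) *\<^sub>R D - p) (z - p) \<le> 0"
    unfolding p_eq by (rule closest_point_dot[OF C(2,1) z])
  then have "L * inner (y + (1 / L) *\<^sub>R D - p) (z - p) \<le> 0"
    using L by (simp add: mult_le_0_iff)
  then have "L * inner (y - p) (z - p) + inner D (z - p) \<le> 0"
    using L by (simp add: algebra_simps)
  moreover have "d z \<le> d y + inner D (z - y)" "d y + inner D (p - y) - L / 2 * (norm (p - y))\<^sup>2 \<le> d p"
    using d by (auto simp: smooth_concave_def D_def)
  moreover have "inner D (z - p) = inner D (z - y) - inner D (p - y)"
    by (simp add: inner_diff_right)
  moreover have "L / 2 * (norm (p - z))\<^sup>2 - L / 2 * (norm (y - z))\<^sup>2
      = L * inner (y - p) (z - p) - L / 2 * (norm (p - y))\<^sup>2"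
    by (simp add: power2_norm_eq_inner inner_diff_left inner_diff_right inner_commute field_simps)
  ultimately have "d z + (L / 2 * (norm (p - z))\<^sup>2 - L / 2 * (norm (y - z))\<^sup>2) \<le> d p" by linarith
  then show ?thesis by (simp add: p_def)
qed

text \<open>The case \<open>z = y = x\<close> of the previous inequality: the gain of one step cannot exceed the gap.\<close>

lemma gradient_map_ascent:
  assumes "smooth_concave d L" "L > 0" "closed C" "convex C" and x: "x \<in> C"
    and ub: "\<And>z. z \<in> C \<Longrightarrow> d z \<le> m"
  shows "L / 2 * (norm (gradient_map d L C x))\<^sup>2 \<le> m - d x"
proof -
  have "projected_step d L C x \<in> C"
    unfolding projected_step_def using assms by (intro closest_point_in_set) auto
  from ub[OF this] projected_step_ascent[OF assms(1-4) x, of x]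
  show ?thesis by (simp add: gradient_map_def)
qed

text \<open>The recursion for \<open>\<theta>\<close> is the positive root of \<open>s\<^sup>2 - s = \<theta>\<^sub>k\<^sup>2\<close>. This identity makes the potential below
  telescope, and the growth of \<open>\<theta>\<close>, by at least one half per step, gives the rate \<open>1/k\<^sup>2\<close>.\<close>

lemma dfg_run_theta:
  assumes run: "dfg_run d L C S N w x y \<theta>" and k: "k \<in> {1..N}"
  shows "(real k + 1) / 2 \<le> \<theta> k" "(\<theta> (k + 1))\<^sup>2 - \<theta> (k + 1) = (\<theta> k)\<^sup>2" "1 \<le> \<theta> (k + 1)"
proof -
  have step: "\<theta> (k + 1) = (1 + sqrt (1 + 4 * (\<theta> k)\<^sup>2)) / 2" if "k \<in> {1..N}" for k
    using run that unfolding dfg_run_def by blast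
  have low: "1 \<le> k \<Longrightarrow> k \<le> N \<Longrightarrow> (real k + 1) / 2 \<le> \<theta> k" for k
  proof (induction k rule: nat_induct_at_least)
    case base
    then show ?case using run by (simp add: dfg_run_def)
  next
    case (Suc n)
    then have IH: "(real n + 1) / 2 \<le> \<theta> n" by simp
    have "2 * \<theta> n \<le> sqrt (1 + 4 * (\<theta> n)\<^sup>2)" by (rule real_le_rsqrt) (simp add: power_mult_distrib)
    then show ?case using step[of n] Suc IH by simp
  qed
  then show "(real k + 1) / 2 \<le> \<theta> k" using k by simp
  define s where "s = sqrt (1 + 4 * (\<theta> k)\<^sup>2)"
  have s: "s\<^sup>2 = 1 + 4 * (\<theta> k)\<^sup>2" "1 \<le> s" by (simp_all add: s_def)
  have th: "\<theta> (k + 1) = (1 + s) / 2" using step[OF k] by (simp add: s_def)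
  show "(\<theta> (k + 1))\<^sup>2 - \<theta> (k + 1) = (\<theta> k)\<^sup>2"
    unfolding th using s(1) by (simp add: power2_eq_square field_simps)
  show "1 \<le> \<theta> (k + 1)" unfolding th using s(2) by simp
qed

lemma dfg_run_in_set:
  assumes run: "dfg_run d L C S N w x y \<theta>" and C: "closed C" and x0: "x 0 \<in> C" and k: "k \<le> N"
  shows "x k \<in> C"
proof (cases "k = 0")
  case False
  then have "x k = projected_step d L C (y k)" using run k by (auto simp: dfg_run_def)
  then show ?thesis using C x0 by (auto simp: projected_step_def intro!: closest_point_in_set)
qed (use x0 in simp)

text \<open>The potential function of accelerated gradient methods. The ascent inequality is applied at the
  convex combination \<open>q = (1 - 1/\<theta>) x\<^sub>n + (1/\<theta>) z\<close>, with \<open>\<theta>\<close> the next parameter, and multiplied by \<open>\<theta>\<^sup>2\<close>. The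
  extrapolated point is chosen so that \<open>\<theta> (y\<^sub>n\<^sub>+\<^sub>1 - q)\<close> is exactly the vector in the potential at step \<open>n\<close>,
  while \<open>\<theta> (x\<^sub>n\<^sub>+\<^sub>1 - q)\<close> is the one at step \<open>n + 1\<close>; by concavity, \<open>d q\<close> contributes the weight
  \<open>\<theta>\<^sup>2 - \<theta> = \<theta>\<^sub>n\<^sup>2\<close> for the old gap.\<close>

lemma dfg_run_potential:
  assumes d: "smooth_concave d L" and L: "L > 0" and C: "closed C" "convex C"
    and run: "dfg_run d L C S N w x y \<theta>" and x0: "x 0 \<in> C" and z: "z \<in> C" and k: "1 \<le> k" "k \<le> N"
  shows "(\<theta> k)\<^sup>2 * (d z - d (x k)) + L / 2 * (norm (\<theta> k *\<^sub>R x k - (\<theta> k - 1) *\<^sub>R x (k - 1) - z))\<^sup>2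
    \<le> L / 2 * (norm (x 0 - z))\<^sup>2"
  using k
proof (induction k rule: nat_induct_at_least)
  case base
  then have "x 1 = projected_step d L C (x 0)" "\<theta> 1 = 1" using run by (auto simp: dfg_run_def)
  then show ?case using projected_step_ascent[OF d L C z, of "x 0"] by simp
next
  case (Suc n)
  define t where "t = \<theta> (Suc n)"
  have n: "n \<in> {1..N}" "n + 1 \<in> {1..N}" using Suc by auto
  have t: "1 \<le> t" "t\<^sup>2 - t = (\<theta> n)\<^sup>2"
    using dfg_run_theta(2,3)[OF run n(1)] by (auto simp: t_def)
  define q where "q = (1 - 1 / t) *\<^sub>R x n + (1 / t) *\<^sub>R z"
  have xn: "x n \<in> C" using dfg_run_in_set[OF run C(1) x0, of n] n by simp
  then have q: "q \<in> C" unfolding q_def using C(2) z t by (intro convexD) auto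
  have xS: "x (Suc n) = projected_step d L C (y (Suc n))"
    using run n(2) by (auto simp: dfg_run_def)
  have yS: "y (Suc n) = x n + ((\<theta> n - 1) / t) *\<^sub>R (x n - x (n - 1))"
    using run n(1) by (auto simp: dfg_run_def t_def)
  have "(1 - 1 / t) * d (x n) + (1 / t) * d z \<le> d q"
    unfolding q_def using t by (intro smooth_concave_concave[OF d]) auto
  then have "t\<^sup>2 * ((1 - 1 / t) * d (x n) + (1 / t) * d z) \<le> t\<^sup>2 * d q"
    by (intro mult_left_mono) auto
  then have conc: "(t\<^sup>2 - t) * d (x n) + t * d z \<le> t\<^sup>2 * d q"
    using t(1) by (simp add: power2_eq_square right_diff_distrib left_diff_distrib distrib_left)
  have "d q + L / 2 * (norm (x (Suc n) - q))\<^sup>2 - L / 2 * (norm (y (Suc n) - q))\<^sup>2 \<le> d (x (Suc n))"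
    unfolding xS by (rule projected_step_ascent[OF d L C q])
  then have scaled: "t\<^sup>2 * (d q + L / 2 * (norm (x (Suc n) - q))\<^sup>2 - L / 2 * (norm (y (Suc n) - q))\<^sup>2)
      \<le> t\<^sup>2 * d (x (Suc n))"
    by (intro mult_left_mono) auto
  have norm_scale: "(norm (t *\<^sub>R (a - q)))\<^sup>2 = t\<^sup>2 * (norm (a - q))\<^sup>2" for a
    by (simp add: power_mult_distrib)
  have tq: "t *\<^sub>R q = (t - 1) *\<^sub>R x n + z"
    using t(1) by (simp add: q_def algebra_simps)
  have tx: "t *\<^sub>R x (Suc n) - (t - 1) *\<^sub>R x n - z = t *\<^sub>R (x (Suc n) - q)"
    by (simp add: scaleR_diff_right tq)
  have "t *\<^sub>R y (Suc n) = t *\<^sub>R x n + (\<theta> n - 1) *\<^sub>R (x n - x (n - 1))"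
    unfolding yS scaleR_add_right scaleR_scaleR using t(1) by simp
  then have ty: "\<theta> n *\<^sub>R x n - (\<theta> n - 1) *\<^sub>R x (n - 1) - z = t *\<^sub>R (y (Suc n) - q)"
    by (simp add: tq scaleR_diff_right scaleR_diff_left)
  have "t\<^sup>2 * d q + L / 2 * (norm (t *\<^sub>R x (Suc n) - (t - 1) *\<^sub>R x n - z))\<^sup>2
      - L / 2 * (norm (\<theta> n *\<^sub>R x n - (\<theta> n - 1) *\<^sub>R x (n - 1) - z))\<^sup>2 \<le> t\<^sup>2 * d (x (Suc n))"
    unfolding tx ty norm_scale using scaled by (simp only: distrib_left right_diff_distrib mult.left_commute)
  with conc have "t\<^sup>2 * (d z - d (x (Suc n))) + L / 2 * (norm (t *\<^sub>R x (Suc n) - (t - 1) *\<^sub>R x n - z))\<^sup>2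
     \<le> (t\<^sup>2 - t) * (d z - d (x n)) + L / 2 * (norm (\<theta> n *\<^sub>R x n - (\<theta> n - 1) *\<^sub>R x (n - 1) - z))\<^sup>2"
    by (simp add: algebra_simps)
  also have "\<dots> \<le> L / 2 * (norm (x 0 - z))\<^sup>2" using Suc t(2) by simp
  finally show ?case by (simp add: t_def)
qed

lemma dfg_run_rate:
  assumes d: "smooth_concave d L" and L: "L > 0" and C: "closed C" "convex C"
    and run: "dfg_run d L C S N w x y \<theta>" and x0: "x 0 \<in> C" and z: "z \<in> maximizers d C" and N: "1 \<le> N"
  shows "d z - d (x N) \<le> 2 * L * (norm (x 0 - z))\<^sup>2 / (real N + 1)\<^sup>2"
proof -
  have zC: "z \<in> C" and opt: "d (x N) \<le> d z"
    using z dfg_run_in_set[OF run C(1) x0, of N] by (auto simp: maximizers_def)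
  have th: "(real N + 1) / 2 \<le> \<theta> N" using dfg_run_theta(1)[OF run, of N] N by simp
  have "((real N + 1) / 2)\<^sup>2 * (d z - d (x N)) \<le> (\<theta> N)\<^sup>2 * (d z - d (x N))"
    using opt th by (intro mult_right_mono power_mono) auto
  also have "\<dots> \<le> L / 2 * (norm (x 0 - z))\<^sup>2"
    using dfg_run_potential[OF d L C run x0 zC N order_refl] L
    by (smt (verit) mult_nonneg_nonneg zero_le_power2 divide_nonneg_nonneg)
  finally have "(d z - d (x N)) * (real N + 1)\<^sup>2 \<le> 2 * L * (norm (x 0 - z))\<^sup>2"
    by (simp add: power_divide mult.commute)
  then show ?thesis by (subst pos_le_divide_eq) auto
qed

section \<open>Linear convergence of the restarted method\<close>

text \<open>The maximizers form a closed set, so the projection of the starting point onto it is a maximizer and may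
  serve as the reference point in the rate. The error bound and the ascent of a single projected step bound
  the squared distance to it by \<open>2 \<kappa>\<^sup>2 / L\<close> times the initial gap.\<close>

lemma dfg_run_contraction:
  assumes d: "smooth_concave d L" and L: "L > 0" and C: "closed C" "convex C"
    and cont: "continuous_on C d"
    and run: "dfg_run d L C S N w x y \<theta>" and x0: "x 0 \<in> C" and N: "1 \<le> N"
    and m: "\<And>z. z \<in> C \<Longrightarrow> d z \<le> m" and att: "\<exists>z\<in>C. d z = m"
    and \<kappa>: "\<kappa> > 0" and eb: "error_bound_const m d L C M \<kappa>" and M: "m - d (x 0) \<le> M"
  shows "m - d (x N) \<le> (2 * \<kappa> / (real N + 1))\<^sup>2 * (m - d (x 0))"
proof -
  have max_eq: "maximizers d C = C \<inter> d -` {m}"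
  proof -
    obtain a where "a \<in> C" "d a = m" using att by blast
    then show ?thesis using m unfolding maximizers_def by (auto intro: antisym)
  qed
  have cl: "closed (maximizers d C)"
    unfolding max_eq using cont C(1) by (intro continuous_closed_preimage) auto
  define z where "z = closest_point (maximizers d C) (x 0)"
  have z: "z \<in> maximizers d C"
    unfolding z_def using att by (intro closest_point_in_set cl) (auto simp: max_eq)
  then have dz: "d z = m" by (simp add: max_eq)
  define r where "r = norm (gradient_map d L C (x 0))"
  have "norm (x 0 - z) \<le> \<kappa> * r"
    using eb x0 M by (simp add: error_bound_const_def z_def r_def)
  then have "(norm (x 0 - z))\<^sup>2 \<le> (\<kappa> * r)\<^sup>2" by (intro power_mono) auto
  then have "2 * L * (norm (x 0 - z))\<^sup>2 \<le> 2 * L * (\<kappa> * r)\<^sup>2" using L by simp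
  also have "\<dots> = 4 * \<kappa>\<^sup>2 * (L / 2 * r\<^sup>2)" by (simp add: power_mult_distrib)
  also have "\<dots> \<le> 4 * \<kappa>\<^sup>2 * (m - d (x 0))"
    unfolding r_def by (intro mult_left_mono gradient_map_ascent[OF d L C x0 m]) auto
  finally have "2 * L * (norm (x 0 - z))\<^sup>2 \<le> 4 * \<kappa>\<^sup>2 * (m - d (x 0))" .
  then have "2 * L * (norm (x 0 - z))\<^sup>2 / (real N + 1)\<^sup>2 \<le> 4 * \<kappa>\<^sup>2 * (m - d (x 0)) / (real N + 1)\<^sup>2"
    by (intro divide_right_mono) auto
  with dfg_run_rate[OF d L C run x0 z N] dz
  show ?thesis by (simp add: power_divide power_mult_distrib)
qed

text \<open>Since \<open>q \<le> 1\<close>, the gap at the restart points never exceeds its initial value. Hence all of them stay in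
  the level set on which \<open>\<kappa>\<close> is a valid error bound constant, and the contraction can be iterated.\<close>

lemma restarted_dfg_linear_convergence:
  assumes d: "smooth_concave d L" and L: "L > 0" and C: "closed C" "convex C"
    and cont: "continuous_on C d"
    and run: "restarted_dfg d L C S N x0 w x y \<theta>" and x0: "x0 \<in> C" and N: "1 \<le> N"
    and m: "\<And>z. z \<in> C \<Longrightarrow> d z \<le> m" and att: "\<exists>z\<in>C. d z = m"
    and \<kappa>: "\<kappa> > 0" and eb: "error_bound_const m d L C (m - d x0) \<kappa>"
    and q: "2 * \<kappa> / (real N + 1) \<le> q" "q \<le> 1"
  shows "x 0 j \<in> C \<and> m - d (x 0 j) \<le> q ^ (2 * j) * (m - d x0)"
proof (induction j)
  case 0
  then show ?case using run x0 by (simp add: restarted_dfg_def)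
next
  case (Suc j)
  have r: "dfg_run d L C S N (\<lambda>k. w k j) (\<lambda>k. x k j) (\<lambda>k. y k j) (\<lambda>k. \<theta> k j)"
    and nxt: "x 0 (Suc j) = x N j"
    using run by (auto simp: restarted_dfg_def)
  have gap0: "0 \<le> m - d x0" using m[OF x0] by simp
  have q0: "0 \<le> q" using q(1) \<kappa> by (smt (verit) divide_nonneg_nonneg of_nat_0_le_iff)
  have "q ^ (2 * j) * (m - d x0) \<le> 1 * (m - d x0)"
    using q0 q(2) gap0 by (intro mult_right_mono power_le_one)
  with Suc have le: "m - d (x 0 j) \<le> m - d x0" by auto
  have "m - d (x N j) \<le> (2 * \<kappa> / (real N + 1))\<^sup>2 * (m - d (x 0 j))"
    using dfg_run_contraction[OF d L C cont r _ N m att \<kappa> eb] Suc le by simp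
  also have "\<dots> \<le> q\<^sup>2 * (q ^ (2 * j) * (m - d x0))"
    using q(1) \<kappa> Suc m by (intro mult_mono power_mono) auto
  finally have "m - d (x N j) \<le> q ^ (2 * Suc j) * (m - d x0)"
    by (simp add: power_add[symmetric] mult.assoc[symmetric] power2_eq_square)
  moreover have "x N j \<in> C" using dfg_run_in_set[OF r C(1), of N] Suc by simp
  ultimately show ?case by (simp add: nxt)
qed

section \<open>The dual problem\<close>

lemma dual_cone_closed_convex: "closed (dual_cone K)" "convex (dual_cone K)"
proof -
  have eq: "dual_cone K = (\<Inter>z\<in>K. {x. inner z x \<ge> 0})"
    by (auto simp: dual_cone_def inner_commute)
  show "closed (dual_cone K)" unfolding eq by (intro closed_INT ballI closed_halfspace_ge)
  show "convex (dual_cone K)" unfolding eq by (intro convex_INT convex_halfspace_ge)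
qed

lemma lagrangian_strongly_convex:
  fixes f :: "real^'n \<Rightarrow> real" and G :: "real^'n^'m" and g x :: "real^'m"
  assumes "strongly_convex \<sigma> f"
  shows "strongly_convex \<sigma> (\<lambda>u. lagrangian f G g u x)"
  unfolding strongly_convex_def
proof (intro allI ballI)
  fix u v :: "real^'n" and t :: real assume t: "t \<in> {0..1}"
  have "inner x (G *v ((1 - t) *\<^sub>R u + t *\<^sub>R v) + g)
      = (1 - t) * inner x (G *v u + g) + t * inner x (G *v v + g)"
    by (simp add: algebra_simps)
  with strongly_convexD[OF assms, of t u v] t
  show "lagrangian f G g ((1 - t) *\<^sub>R u + t *\<^sub>R v) x
     \<le> (1 - t) * lagrangian f G g u x + t * lagrangian f G g v x
       - \<sigma> / 2 * t * (1 - t) * (norm (u - v))\<^sup>2"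
    by (simp add: lagrangian_def algebra_simps)
qed

text \<open>The minimizer is defined through a choice operator and the dual function as an infimum; strong
  convexity of the Lagrangian turns both into what their names promise.\<close>

lemma dual_fun_eq_lagrangian_minimizer:
  fixes G :: "real^'n^'m" and g x :: "real^'m"
  assumes sc: "strongly_convex \<sigma> f" and \<sigma>: "\<sigma> > 0" and U: "U \<noteq> {}" "closed U" "convex U"
  defines "u \<equiv> lagrangian_minimizer f U G g x"
  shows "u \<in> U" and "dual_fun f U G g x = lagrangian f G g u x"
    and "v \<in> U \<Longrightarrow> dual_fun f U G g x + \<sigma> / 2 * (norm (u - v))\<^sup>2 \<le> lagrangian f G g v x"
proof -
  let ?h = "\<lambda>u. lagrangian f G g u x"
  have sc': "strongly_convex \<sigma> ?h" by (rule lagrangian_strongly_convex[OF sc])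
  have "\<exists>u. is_arg_min ?h (\<lambda>u. u \<in> U) u"
    using strongly_convex_minimum_exists[OF sc' \<sigma> U(2,1)] by (force simp: is_arg_min_def not_less)
  then have "is_arg_min ?h (\<lambda>u. u \<in> U) u"
    unfolding u_def lagrangian_minimizer_def arg_min_on_def arg_min_def by (rule someI_ex)
  then have *: "u \<in> U" "\<And>v. v \<in> U \<Longrightarrow> ?h u \<le> ?h v" by (auto simp: is_arg_min_def not_less)
  show "u \<in> U" by fact
  show **: "dual_fun f U G g x = ?h u"
    unfolding dual_fun_def using * by (intro cInf_eq_minimum) auto
  show "dual_fun f U G g x + \<sigma> / 2 * (norm (u - v))\<^sup>2 \<le> ?h v" if "v \<in> U"
    unfolding ** by (rule strongly_convex_quadratic_growth[OF sc' U(3) * that])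
qed

text \<open>The gradient is \<open>- (G u(y) + g)\<close>. The upper bound comes from inserting the minimizer for \<open>y\<close> into the
  Lagrangian at \<open>z\<close>. For the lower bound, the minimizer for \<open>z\<close> is inserted into the Lagrangian at \<open>y\<close>:
  the error \<open>\<langle>z - y, G (u(z) - u(y))\<rangle>\<close> is at most \<open>\<parallel>G\<parallel> \<parallel>z - y\<parallel> \<parallel>u(z) - u(y)\<parallel>\<close>, and the quadratic growth
  \<open>\<sigma>/2 \<parallel>u(z) - u(y)\<parallel>\<^sup>2\<close> absorbs it up to \<open>\<parallel>G\<parallel>\<^sup>2 \<parallel>z - y\<parallel>\<^sup>2 / (2 \<sigma>)\<close>.\<close>

lemma dual_fun_smooth_concave:
  fixes G :: "real^'n^'m"
  assumes sc: "strongly_convex \<sigma> f" and \<sigma>: "\<sigma> > 0" and U: "U \<noteq> {}" "closed U" "convex U"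
  shows "smooth_concave (dual_fun f U G g) (dual_lipschitz \<sigma> G)"
    and "continuous_on A (dual_fun f U G g)"
proof -
  let ?d = "dual_fun f U G g" and ?u = "lagrangian_minimizer f U G g"
  let ?D = "\<lambda>y. - (G *v ?u y + g)"
  note D = dual_fun_eq_lagrangian_minimizer[OF sc \<sigma> U, where G = G and g = g]
  have up: "?d z \<le> ?d y + inner (?D y) (z - y)" for y z
  proof -
    have "0 \<le> \<sigma> / 2 * (norm (?u z - ?u y))\<^sup>2" using \<sigma> by simp
    then have "?d z \<le> lagrangian f G g (?u y) z" using D(3)[OF D(1), of z y] by linarith
    also have "\<dots> = ?d y + inner (?D y) (z - y)"
      unfolding D(2)[of y] by (simp add: lagrangian_def inner_commute algebra_simps)
    finally show ?thesis .
  qed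
  have lo: "?d y + inner (?D y) (z - y) - dual_lipschitz \<sigma> G / 2 * (norm (z - y))\<^sup>2 \<le> ?d z" for y z
  proof -
    define a where "a = norm (?u y - ?u z)"
    define b where "b = onorm ((*v) G) * norm (z - y)"
    have growth: "?d y + \<sigma> / 2 * a\<^sup>2 \<le> lagrangian f G g (?u z) y"
      unfolding a_def by (rule D(3)[OF D(1)])
    have "?d z = lagrangian f G g (?u z) y + inner (?D y) (z - y) - inner (z - y) (G *v (?u z - ?u y))"
      unfolding D(2)[of z]
      by (simp add: lagrangian_def inner_commute algebra_simps)
    moreover have "inner (z - y) (G *v (?u z - ?u y)) \<le> b * a"
    proof -
      have "inner (z - y) (G *v (?u z - ?u y)) \<le> norm (z - y) * norm (G *v (?u z - ?u y))"
        by (rule norm_cauchy_schwarz)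
      also have "\<dots> \<le> norm (z - y) * (onorm ((*v) G) * norm (?u z - ?u y))"
        by (intro mult_left_mono onorm matrix_vector_mul_bounded_linear) auto
      finally show ?thesis by (simp add: a_def b_def norm_minus_commute algebra_simps)
    qed
    moreover have "b * a \<le> \<sigma> / 2 * a\<^sup>2 + b\<^sup>2 / (2 * \<sigma>)"
    proof -
      have "0 \<le> (\<sigma> * a - b)\<^sup>2 / (2 * \<sigma>)" using \<sigma> by simp
      also have "\<dots> = \<sigma> / 2 * a\<^sup>2 + b\<^sup>2 / (2 * \<sigma>) - b * a"
        using \<sigma> by (simp add: power2_eq_square field_simps)
      finally show ?thesis by linarith
    qed
    moreover have "dual_lipschitz \<sigma> G / 2 * (norm (z - y))\<^sup>2 = b\<^sup>2 / (2 * \<sigma>)"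
      by (simp add: dual_lipschitz_def b_def power_mult_distrib)
    ultimately show ?thesis using growth by linarith
  qed
  show "smooth_concave ?d (dual_lipschitz \<sigma> G)" and "continuous_on A ?d"
    using smooth_concave_from_bounds[of ?d ?D "dual_lipschitz \<sigma> G", OF up lo] by auto
qed

lemma dual_lipschitz_pos:
  fixes G :: "real^'n^'m"
  assumes "\<sigma> > 0" "G \<noteq> 0"
  shows "dual_lipschitz \<sigma> G > 0"
proof -
  have "\<exists>v. G *v v \<noteq> 0"
    using assms(2) matrix_eq[of G 0] by auto
  then have "onorm ((*v) G) \<noteq> 0"
    using onorm_eq_0[OF matrix_vector_mul_bounded_linear[of G]] by auto
  then show ?thesis using assms by (simp add: dual_lipschitz_def)
qed

lemma opt_value_attained:
  fixes f :: "real^'n \<Rightarrow> real"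
  assumes "strongly_convex \<sigma> f" "\<sigma> > 0" "closed U" "closed K" "feasible U G g K \<noteq> {}"
  obtains u where "u \<in> U" "G *v u + g \<in> K" "f u = opt_value f U G g K"
proof -
  have eq: "feasible U G g K = U \<inter> (\<lambda>u. G *v u + g) -` K"
    by (auto simp: feasible_def)
  have "closed (feasible U G g K)"
    unfolding eq using assms(3,4)
    by (intro continuous_closed_preimage continuous_intros
        linear_continuous_on matrix_vector_mul_bounded_linear) auto
  from strongly_convex_minimum_exists[OF assms(1,2) this assms(5)]
  obtain u where u: "u \<in> feasible U G g K" "\<forall>v\<in>feasible U G g K. f u \<le> f v" by blast
  then have "opt_value f U G g K = f u"
    unfolding opt_value_def by (intro cInf_eq_minimum) auto
  with u show thesis by (intro that) (auto simp: feasible_def)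
qed

text \<open>The growth bound for the Lagrangian at \<open>x\<close>, evaluated at a feasible \<open>u\<close>: there the multiplier term has
  the right sign, so the Lagrangian is at most \<open>f u\<close>. As the left-hand side is nonnegative, weak duality is
  contained in this inequality.\<close>

lemma primal_distance_le_dual_gap:
  assumes sc: "strongly_convex \<sigma> f" and \<sigma>: "\<sigma> > 0" and U: "U \<noteq> {}" "closed U" "convex U"
    and u: "u \<in> U" "G *v u + g \<in> K" and x: "x \<in> dual_cone K"
  shows "\<sigma> / 2 * (norm (lagrangian_minimizer f U G g x - u))\<^sup>2 \<le> f u - dual_fun f U G g x"
proof -
  have "lagrangian f G g u x \<le> f u" using x u(2) by (simp add: lagrangian_def dual_cone_def)
  with dual_fun_eq_lagrangian_minimizer(3)[OF sc \<sigma> U u(1), of G g x] show ?thesis by linarith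
qed

section \<open>Convergence of the primal iterate\<close>

theorem theorem5p5:
  fixes f :: "real^'n \<Rightarrow> real" and \<sigma> \<kappa> :: real
    and U :: "(real^'n) set" and G :: "real^'n^'m" and g :: "real^'m" and K :: "(real^'m) set"
    and x00 :: "real^'m"
  defines "d \<equiv> dual_fun f U G g"
    and "L \<equiv> dual_lipschitz \<sigma> G"
    and "fstar \<equiv> opt_value f U G g K"
    and "umin \<equiv> lagrangian_minimizer f U G g"
    and "Kc \<equiv> nat \<lfloor>2 * exp 1 * \<kappa>\<rfloor>"
  assumes "\<sigma> > 0" and "strongly_convex \<sigma> f"
    and "U \<noteq> {}" and "closed U" and "convex U"
    and "G \<noteq> 0" and "proper_cone K"
    and feasible_nonempty: "feasible U G g K \<noteq> {}"
    and lagrange_multiplier: "\<exists>x\<in>dual_cone K. d x = fstar"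
    and "error_bound_property fstar d L (dual_cone K)"
    and "x00 \<in> dual_cone K"
    and "\<kappa> > 0" and "error_bound_const fstar d L (dual_cone K) (fstar - d x00) \<kappa>"
  shows "\<exists>C1>0. \<exists>C2>0. \<forall>w x y \<theta>.
    restarted_dfg d L (dual_cone K) umin Kc x00 w x y \<theta> \<longrightarrow>
    (\<forall>\<epsilon>\<in>{0<..<1}. \<forall>p\<ge>1. real (p * Kc) \<ge> C1 * ln (1 / \<epsilon>) \<longrightarrow>
       approx_primal_solution f U G g K C2 \<epsilon> (umin (x Kc (p - 1))))"
proof -
  note \<sigma> = \<open>\<sigma> > 0\<close> and sc = \<open>strongly_convex \<sigma> f\<close>
  note U = \<open>U \<noteq> {}\<close> \<open>closed U\<close> \<open>convex U\<close>
  let ?C = "dual_cone K"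
  have "closed K" using \<open>proper_cone K\<close> by (simp add: proper_cone_def)
  then obtain us where us: "us \<in> U" "G *v us + g \<in> K" "f us = fstar"
    using opt_value_attained[OF sc \<sigma> \<open>closed U\<close> _ feasible_nonempty] unfolding fstar_def by blast
  have dist: "\<sigma> / 2 * (norm (umin x - us))\<^sup>2 \<le> fstar - d x" if "x \<in> ?C" for x
    using primal_distance_le_dual_gap[OF sc \<sigma> U us(1,2) that] us(3) by (simp add: d_def umin_def)
  have weak: "d x \<le> fstar" if "x \<in> ?C" for x
  proof -
    have "0 \<le> \<sigma> / 2 * (norm (umin x - us))\<^sup>2" using \<sigma> by simp
    with dist[OF that] show ?thesis by linarith
  qed
  define \<Delta> where "\<Delta> = fstar - d x00"
  \<comment> \<open>A dual gap of at most \<open>\<epsilon>\<^sup>2 \<Delta>\<close> will place the primal iterate within \<open>\<epsilon> R\<close> of \<open>us\<close>.\<close>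
  define R where "R = sqrt (2 * \<Delta> / \<sigma>)"
  have \<Delta>: "0 \<le> \<Delta>" using weak \<open>x00 \<in> ?C\<close> by (simp add: \<Delta>_def)
  then have R: "0 \<le> R" "R\<^sup>2 = 2 * \<Delta> / \<sigma>" using \<sigma> by (auto simp: R_def)
  obtain B where B: "B \<ge> 0"
    "\<And>\<epsilon> v. 0 < \<epsilon> \<Longrightarrow> \<epsilon> < 1 \<Longrightarrow> norm (v - us) \<le> \<epsilon> * R \<Longrightarrow> \<bar>f v - f us\<bar> \<le> B * \<epsilon>"
    using convex_local_linear_bound[OF strongly_convex_imp_convex_on[OF sc \<sigma>], of us R] by auto
  define N where "N = onorm ((*v) G)"
  have N: "0 \<le> N" unfolding N_def by (intro onorm_pos_le matrix_vector_mul_bounded_linear)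
  define C2 where "C2 = 1 + N * R + B"
  have C2: "C2 > 0" "N * R \<le> C2" "B \<le> C2"
    using N R B(1) by (auto simp: C2_def add_pos_nonneg)
  have main: "approx_primal_solution f U G g K C2 \<epsilon> (umin (x Kc (p - 1)))"
    if run: "restarted_dfg d L ?C umin Kc x00 w x y \<theta>" and \<epsilon>: "0 < \<epsilon>" "\<epsilon> < 1"
      and p: "p \<ge> 1" "real (p * Kc) \<ge> max 1 (real Kc) * ln (1 / \<epsilon>)" for w x y \<theta> \<epsilon> p
  proof -
    \<comment> \<open>The lower bound on the number of iterations is positive, which excludes an empty restart interval.\<close>
    have ln: "ln (1 / \<epsilon>) > 0" using \<epsilon> by simp
    then have "0 < max 1 (real Kc) * ln (1 / \<epsilon>)" by (intro mult_pos_pos) auto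
    with p have "0 < real (p * Kc)" by linarith
    then have Kc: "1 \<le> Kc" by (cases Kc) auto
    with p(2) have "ln (1 / \<epsilon>) \<le> real p" by (simp add: max_def mult.commute)
    then have "- real p \<le> ln \<epsilon>" using \<epsilon> by (simp add: ln_div)
    then have exp_p: "exp (- real p) \<le> \<epsilon>" using \<epsilon> by (simp add: ln_ge_iff)
    define q :: real where "q = exp (- 1)"
    \<comment> \<open>The \<open>+ 1\<close> in the rate makes up for rounding \<open>2 e \<kappa>\<close> down.\<close>
    have "2 * exp 1 * \<kappa> < real Kc + 1"
      unfolding Kc_def using \<open>\<kappa> > 0\<close> by linarith
    then have q: "2 * \<kappa> / (real Kc + 1) \<le> q" "q \<le> 1"
      by (auto simp: q_def exp_minus field_simps)
    define X where "X = x Kc (p - 1)"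
    \<comment> \<open>The result of run \<open>p - 1\<close>, counted from \<open>0\<close>, is the starting point of run \<open>p\<close>.\<close>
    have X_eq: "X = x 0 p" using run p(1) by (auto simp: restarted_dfg_def X_def dest: spec[of _ "p - 1"])
    have X: "X \<in> ?C" "fstar - d X \<le> q ^ (2 * p) * \<Delta>"
      using restarted_dfg_linear_convergence[OF
          dual_fun_smooth_concave(1)[OF sc \<sigma> U, of G g, folded d_def L_def]
          dual_lipschitz_pos[OF \<sigma> \<open>G \<noteq> 0\<close>, folded L_def] dual_cone_closed_convex
          dual_fun_smooth_concave(2)[OF sc \<sigma> U, of _ G g, folded d_def]
          run \<open>x00 \<in> ?C\<close> Kc weak lagrange_multiplier \<open>\<kappa> > 0\<close>
          \<open>error_bound_const fstar d L ?C (fstar - d x00) \<kappa>\<close> q, of p]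
      by (auto simp: X_eq \<Delta>_def)
    have "q ^ p = exp (- real p)" using exp_of_nat_mult[of p "- 1 :: real"] by (simp add: q_def)
    then have "q ^ (2 * p) = (exp (- real p))\<^sup>2" by (simp only: power_even_eq)
    also have "\<dots> \<le> \<epsilon>\<^sup>2" using exp_p by (intro power_mono) auto
    finally have "fstar - d X \<le> \<epsilon>\<^sup>2 * \<Delta>" using X(2) \<Delta> by (meson mult_right_mono order_trans)
    with dist[OF X(1)] have "\<sigma> / 2 * (norm (umin X - us))\<^sup>2 \<le> \<epsilon>\<^sup>2 * \<Delta>" by linarith
    then have "(norm (umin X - us))\<^sup>2 \<le> (\<epsilon> * R)\<^sup>2"
      using \<sigma> by (simp add: R(2) field_simps)
    then have close: "norm (umin X - us) \<le> \<epsilon> * R"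
      by (rule power2_le_imp_le) (use \<epsilon> R(1) in auto)
    have "\<bar>f (umin X) - fstar\<bar> \<le> B * \<epsilon>" using B(2)[OF \<epsilon> close] us(3) by simp
    also have "\<dots> \<le> C2 * \<epsilon>" using C2 \<epsilon> by (intro mult_right_mono) auto
    finally have val: "\<bar>f (umin X) - fstar\<bar> \<le> C2 * \<epsilon>" .
    have "infdist (G *v umin X + g) K \<le> dist (G *v umin X + g) (G *v us + g)"
      by (rule infdist_le[OF us(2)])
    also have "\<dots> = norm (G *v (umin X - us))"
      by (simp add: dist_norm matrix_vector_mult_diff_distrib)
    also have "\<dots> \<le> N * norm (umin X - us)"
      unfolding N_def by (intro onorm matrix_vector_mul_bounded_linear)
    also have "\<dots> \<le> N * (\<epsilon> * R)" using N close by (intro mult_left_mono)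
    also have "\<dots> = N * R * \<epsilon>" by simp
    also have "\<dots> \<le> C2 * \<epsilon>" using C2 \<epsilon> by (intro mult_right_mono) auto
    finally have "infdist (G *v umin X + g) K \<le> C2 * \<epsilon>" .
    moreover have "umin X \<in> U"
      unfolding umin_def by (rule dual_fun_eq_lagrangian_minimizer(1)[OF sc \<sigma> U])
    ultimately show ?thesis
      using val unfolding approx_primal_solution_def X_def[symmetric] fstar_def[symmetric] by auto
  qed
  show ?thesis
    by (rule exI[of _ "max 1 (real Kc)"], rule conjI, simp, rule exI[of _ C2]) (use C2(1) main in auto)
qed

end
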